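(* Assume: (a) $U(u,t)$ is nondecreasing in $u$ and in $t$, and $\lim_{t\to+\infty}U(u,t)=+\infty$ for every $u\ge 0$; (b) there exist constants $u_*\ge 0$, $c_*>0$, $L>0$ such that $U(u,t)\ge u+c_*t$ for all $u\ge u_*$, $t\ge 0$, and $$\int_0^{+\infty}e^{Lz}\,dF(z)\int_0^{+\infty}e^{-c_*Lt}\,dK(t)\le 1;$$ (c) $K(t)\,F(z)<1$ for all $t,z\ge 0$. Let $\varphi_*(u)=\max\{0,1-e^{-L(u-u_* )}\}$, let $\varphi:[0,+\infty)\to[0,1]$ be the (unique) nondecreasing solution of $\varphi=A\varphi$ with $\lim_{u\to+\infty}\varphi(u)=1$, and let $\varphi^{k+1}=A\varphi^k$, $k=0,1,\dots$, where $1\ge\varphi^0(u)\ge\varphi_*(u)$ for all $u\ge0$. Then $\varphi^k$ converges uniformly to $\varphi$, namely the sequence $\|\varphi^k-\varphi\|=\sup_{u\ge0}|\varphi^k(u)-\varphi(u)|$ tends monotonically to zero. Moreover, for every $\varepsilon>0$ there is $q(\varepsilon)\in[0,1)$ such that $$\|\varphi^k-\varphi\|\le (q(\varepsilon))^k\,\|\varphi^0-\varphi\|$$ for all $k$ such that $\|\varphi^k-\varphi\|\ge\varepsilon$.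
   Context: Let $F$ be the distribution function of a claim size ($F(z)=0$ for $z\le 0$) and $K$ the distribution function of the (nonnegative) time between successive claims. Let $c(\cdot)\ge 0$ be a piecewise continuous premium rate and let $U(u,t)$, $u,t\ge0$, be the solution of the Cauchy problem $dU/dt=c(U)$, $U(u,0)=u$, assumed well defined for all $t\ge 0$. The operator $A$ acts on bounded Borel functions $\varphi:[0,+\infty)\to\mathbb R$ by $$A\varphi(u)=\int_0^{+\infty}\int_0^{U(u,t)}\varphi(U(u,t)-z)\,dF(z)\,dK(t),\qquad u\ge 0,$$ where integrals are Lebesgue–Stieltjes integrals and endpoints of the integration intervals are included. Under (a)–(c) the solution $\varphi$ exists and is unique. All initial functions are Borel measurable. *)

theory Defs
  imports "HOL-Probability.Probability"
begin

definition distribution_function :: "(real \<Rightarrow> real) \<Rightarrow> bool" where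
  "distribution_function G \<longleftrightarrow>
     mono G \<and> (\<forall>x. continuous (at_right x) G) \<and>
     (G \<longlongrightarrow> 0) at_bot \<and> (G \<longlongrightarrow> 1) at_top"

text \<open>Piecewise continuity on the half-line: finitely many discontinuities in every bounded
  interval, with finite one-sided limits everywhere.\<close>

definition piecewise_continuous_halfline :: "(real \<Rightarrow> real) \<Rightarrow> bool" where
  "piecewise_continuous_halfline c \<longleftrightarrow>
     (\<forall>b. \<exists>S. finite S \<and> (\<forall>x\<in>{0..b} - S. continuous (at x within {0..}) c)) \<and>
     (\<forall>x\<ge>0. \<exists>l. (c \<longlongrightarrow> l) (at_right x)) \<and>
     (\<forall>x>0. \<exists>l. (c \<longlongrightarrow> l) (at_left x))"

text \<open>Since \<open>c\<close> may jump, a solution of \<open>dV/dt = c(V)\<close> is a continuous function satisfying the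
  equation outside finitely many points of every bounded time interval.  For piecewise
  continuous \<open>c \<ge> 0\<close> this agrees with the integral (Caratheodory) formulation.  The condition
  \<open>V t \<ge> 0\<close> keeps the trajectory in the domain \<open>[0,\<infinity>)\<close> of \<open>c\<close>.\<close>

definition cauchy_solution :: "(real \<Rightarrow> real) \<Rightarrow> real \<Rightarrow> (real \<Rightarrow> real) \<Rightarrow> bool" where
  "cauchy_solution c u V \<longleftrightarrow>
     V 0 = u \<and> continuous_on {0..} V \<and> (\<forall>t\<ge>0. V t \<ge> 0) \<and>
     (\<forall>T. \<exists>S. finite S \<and>
        (\<forall>t\<in>{0..T} - S. (V has_real_derivative c (V t)) (at t within {0..})))"

definition the_cauchy_flow :: "(real \<Rightarrow> real) \<Rightarrow> (real \<Rightarrow> real \<Rightarrow> real) \<Rightarrow> bool" where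
  "the_cauchy_flow c U \<longleftrightarrow>
     (\<forall>u\<ge>0. cauchy_solution c u (U u) \<and>
        (\<forall>V. cauchy_solution c u V \<longrightarrow> (\<forall>t\<ge>0. V t = U u t)))"

definition survival_op ::
  "(real \<Rightarrow> real \<Rightarrow> real) \<Rightarrow> (real \<Rightarrow> real) \<Rightarrow> (real \<Rightarrow> real) \<Rightarrow> (real \<Rightarrow> real) \<Rightarrow> real \<Rightarrow> real" where
  "survival_op U F K \<phi> u =
     (LINT t:{0..}|interval_measure K.
        (LINT z:{0..U u t}|interval_measure F. \<phi> (U u t - z)))"

definition phi_star :: "real \<Rightarrow> real \<Rightarrow> real \<Rightarrow> real" where
  "phi_star L u\<^sub>0 u = max 0 (1 - exp (- L * (u - u\<^sub>0)))"

definition sup_dist :: "(real \<Rightarrow> real) \<Rightarrow> (real \<Rightarrow> real) \<Rightarrow> real" where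
  "sup_dist f g = (SUP u\<in>{0..}. \<bar>f u - g u\<bar>)"

end

theory Submission imports Defs begin

text \<open>
  Let \<open>W\<^sub>u\<close> be the law of \<open>U(u,T) - Z\<close> with independent \<open>T\<close>, \<open>Z\<close> distributed according to \<open>K\<close>, \<open>F\<close>.
  Extending functions by zero to the negative half-line turns \<open>A f(u)\<close> into \<open>\<integral> f dW\<^sub>u\<close>.
  The exponential moment condition gives \<open>A \<phi>\<^sub>* \<ge> \<phi>\<^sub>*\<close>, so all iterates lie between \<open>\<phi>\<^sub>*\<close> and \<open>1\<close>
  and, for given \<open>\<epsilon>\<close>, differ from \<open>\<phi>\<close> by at most \<open>\<epsilon>/2\<close> beyond some \<open>N\<close> that does not depend on \<open>k\<close>.
  By condition (c) the mass \<open>W\<^sub>u [0,N)\<close> is at most \<open>1 - p\<close> for a single \<open>p > 0\<close> and all \<open>u \<in> [0,N]\<close>.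
  Hence, as long as the distance to \<open>\<phi>\<close> is at least \<open>\<epsilon>\<close>, one application of \<open>A\<close> shrinks it by the
  factor \<open>1 - p/2\<close>.
\<close>

section \<open>Joint measurability of functions continuous in time\<close>

lemma floor_grid_tendsto:
  fixes t :: real
  shows "(\<lambda>n. real_of_int \<lfloor>real (Suc n) * t\<rfloor> / real (Suc n)) \<longlonglongrightarrow> t"
proof (rule real_tendsto_sandwich)
  have "(\<lambda>n. t - inverse (real (Suc n))) \<longlonglongrightarrow> t - 0"
    by (intro tendsto_intros LIMSEQ_inverse_real_of_nat)
  then show "(\<lambda>n. t - inverse (real (Suc n))) \<longlonglongrightarrow> t" by simp
  show "\<forall>\<^sub>F n in sequentially. t - inverse (real (Suc n)) \<le> real_of_int \<lfloor>real (Suc n) * t\<rfloor> / real (Suc n)"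
  proof (rule always_eventually, rule allI)
    fix n
    have "real (Suc n) * t - 1 \<le> real_of_int \<lfloor>real (Suc n) * t\<rfloor>" by linarith
    from divide_right_mono[OF this, of "real (Suc n)"]
    show "t - inverse (real (Suc n)) \<le> real_of_int \<lfloor>real (Suc n) * t\<rfloor> / real (Suc n)"
      by (simp add: diff_divide_distrib inverse_eq_divide del: of_nat_Suc)
  qed
  show "\<forall>\<^sub>F n in sequentially. real_of_int \<lfloor>real (Suc n) * t\<rfloor> / real (Suc n) \<le> t"
  proof (rule always_eventually, rule allI)
    fix n
    have "real_of_int \<lfloor>real (Suc n) * t\<rfloor> \<le> real (Suc n) * t" by linarith
    then show "real_of_int \<lfloor>real (Suc n) * t\<rfloor> / real (Suc n) \<le> t"
      by (simp add: field_simps del: of_nat_Suc)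
  qed
qed simp

text \<open>Rounding time down to multiples of \<open>1 / Suc n\<close> glues together countably
  many functions measurable in the first argument; continuity in time recovers \<open>V\<close> as
  their pointwise limit.\<close>

lemma borel_measurable_caratheodory:
  fixes V :: "'a \<Rightarrow> real \<Rightarrow> real"
  assumes meas: "\<And>t. (\<lambda>u. V u t) \<in> borel_measurable M"
    and cont: "\<And>u. continuous_on UNIV (V u)"
  shows "(\<lambda>p. V (fst p) (snd p)) \<in> borel_measurable (M \<Otimes>\<^sub>M borel)"
proof (rule borel_measurable_LIMSEQ_real)
  fix p :: "'a \<times> real"
  have "isCont (V (fst p)) (snd p)"
    using cont by (simp add: continuous_on_eq_continuous_at)
  then show "(\<lambda>n. V (fst p) (real_of_int \<lfloor>real (Suc n) * snd p\<rfloor> / real (Suc n)))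
      \<longlonglongrightarrow> V (fst p) (snd p)"
    by (rule isCont_tendsto_compose[OF _ floor_grid_tendsto])
next
  fix n
  show "(\<lambda>p. V (fst p) (real_of_int \<lfloor>real (Suc n) * snd p\<rfloor> / real (Suc n)))
      \<in> borel_measurable (M \<Otimes>\<^sub>M borel)"
  proof (rule measurable_compose_countable[where
        f="\<lambda>(i::int) p. V (fst p) (real_of_int i / real (Suc n))" and g="\<lambda>p. \<lfloor>real (Suc n) * snd p\<rfloor>"])
    show "(\<lambda>p. V (fst p) (real_of_int i / real (Suc n))) \<in> borel_measurable (M \<Otimes>\<^sub>M borel)" for i
      using measurable_compose[OF measurable_fst meas] .
  qed measurable
qed

section \<open>Sequences that contract as long as they are large\<close>

text \<open>In a decreasing sequence \<open>\<epsilon> \<le> d k\<close> forces the same at all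
  earlier indices, so the one-step factors multiply. Convergence follows: once
  \<open>q ^ k * d 0 < e\<close>, the alternative \<open>e \<le> d k\<close> contradicts the
  geometric bound.\<close>

lemma geometric_while_large:
  fixes d :: "nat \<Rightarrow> real"
  assumes dec: "decseq d" and nonneg: "\<And>k. 0 \<le> d k"
    and contr: "\<And>\<epsilon>. 0 < \<epsilon> \<Longrightarrow> \<exists>q. 0 \<le> q \<and> q < 1 \<and> (\<forall>k. \<epsilon> \<le> d k \<longrightarrow> d (Suc k) \<le> q * d k)"
  shows "d \<longlonglongrightarrow> 0"
    and "\<forall>\<epsilon>>0. \<exists>q. 0 \<le> q \<and> q < 1 \<and> (\<forall>k. d k \<ge> \<epsilon> \<longrightarrow> d k \<le> q ^ k * d 0)"
proof -
  show geo: "\<forall>\<epsilon>>0. \<exists>q. 0 \<le> q \<and> q < 1 \<and> (\<forall>k. d k \<ge> \<epsilon> \<longrightarrow> d k \<le> q ^ k * d 0)"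
  proof (intro allI impI)
    fix \<epsilon> :: real assume "0 < \<epsilon>"
    then obtain q where q: "0 \<le> q" "q < 1" "\<And>k. \<epsilon> \<le> d k \<Longrightarrow> d (Suc k) \<le> q * d k"
      using contr by blast
    have "\<epsilon> \<le> d k \<longrightarrow> d k \<le> q ^ k * d 0" for k
    proof (induction k)
      case (Suc k)
      show ?case
      proof
        assume "\<epsilon> \<le> d (Suc k)"
        with decseq_SucD[OF dec, of k] have "\<epsilon> \<le> d k" by linarith
        with Suc q(3)[of k] mult_left_mono[OF _ q(1), of "d k" "q ^ k * d 0"]
        show "d (Suc k) \<le> q ^ Suc k * d 0" by (simp add: mult.assoc)
      qed
    qed simp
    with q show "\<exists>q. 0 \<le> q \<and> q < 1 \<and> (\<forall>k. d k \<ge> \<epsilon> \<longrightarrow> d k \<le> q ^ k * d 0)" by blast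
  qed
  show "d \<longlonglongrightarrow> 0"
  proof (rule decreasing_tendsto)
    fix e :: real assume "0 < e"
    then obtain q where q: "0 \<le> q" "q < 1" "\<And>k. d k \<ge> e \<Longrightarrow> d k \<le> q ^ k * d 0"
      using geo by blast
    have "(\<lambda>k. q ^ k * d 0) \<longlonglongrightarrow> 0"
      using tendsto_mult_left_zero[OF LIMSEQ_power_zero[of q]] q by simp
    from order_tendstoD(2)[OF this \<open>0 < e\<close>]
    show "\<forall>\<^sub>F k in sequentially. d k < e"
      by eventually_elim (meson q(3) leI le_less_trans less_le_not_le)
  qed (simp add: nonneg)
qed

section \<open>The kernel of the surplus over one claim\<close>

text \<open>The claim size has law \<open>MF\<close>, the inter-claim time has law \<open>MK\<close>, and \<open>V u t\<close> is the
  surplus at time \<open>t\<close> without claims, extended constantly to negative arguments.\<close>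

locale surplus_model =
  MF: real_distribution MF + MK: real_distribution MK for MF MK :: "real measure" +
  fixes V :: "real \<Rightarrow> real \<Rightarrow> real"
  assumes mono_V: "mono (\<lambda>u. V u t)"
    and mono_V_time: "mono (V u)"
    and cont_V: "continuous_on UNIV (V u)"
    and MF_nonneg: "AE z in MF. 0 \<le> z"
    and MK_nonneg: "AE t in MK. 0 \<le> t"
begin

sublocale pair_prob_space MK MF ..

text \<open>Monotonicity in the initial surplus gives Borel measurability there; continuity in time
  makes it joint.\<close>

lemma measurable_V [measurable (raw)]:
  assumes [measurable]: "f \<in> borel_measurable M" "g \<in> borel_measurable M"
  shows "(\<lambda>x. V (f x) (g x)) \<in> borel_measurable M"
proof -
  have "(\<lambda>p. V (fst p) (snd p)) \<in> borel_measurable (borel \<Otimes>\<^sub>M borel)"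
    by (intro borel_measurable_caratheodory borel_measurable_mono mono_V cont_V)
  from measurable_compose[OF _ this, of "\<lambda>x. (f x, g x)" M] show ?thesis by simp
qed

definition next_surplus :: "real \<Rightarrow> real measure" where
  "next_surplus u = distr (MK \<Otimes>\<^sub>M MF) borel (\<lambda>(t, z). V u t - z)"

lemma sets_next_surplus [simp, measurable_cong]: "sets (next_surplus u) = sets borel"
  by (simp add: next_surplus_def)

lemma space_next_surplus [simp]: "space (next_surplus u) = UNIV"
  by (simp add: next_surplus_def)

lemma prob_space_next_surplus: "prob_space (next_surplus u)"
  unfolding next_surplus_def by (rule prob_space_distr) measurable

lemma integrable_next_surplus:
  fixes f :: "real \<Rightarrow> real"
  assumes "f \<in> borel_measurable borel" "\<And>x. \<bar>f x\<bar> \<le> B"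
  shows "integrable (next_surplus u) f"
proof -
  interpret prob_space "next_surplus u" by (rule prob_space_next_surplus)
  show ?thesis using assms by (intro integrable_const_bound[of _ B]) auto
qed

lemma integral_next_surplus:
  fixes f :: "real \<Rightarrow> real"
  assumes [measurable]: "f \<in> borel_measurable borel" and "\<And>x. \<bar>f x\<bar> \<le> B"
  shows "(\<integral>x. f x \<partial>next_surplus u) = (\<integral>t. \<integral>z. f (V u t - z) \<partial>MF \<partial>MK)"
proof -
  have "integrable (MK \<Otimes>\<^sub>M MF) (\<lambda>p. f (V u (fst p) - snd p))"
    using assms by (intro P.integrable_const_bound[of _ B]) auto
  from integral_fst'[OF this] show ?thesis
    by (simp add: next_surplus_def integral_distr split_def)
qed

lemma measurable_integral_next_surplus:
  fixes f :: "real \<Rightarrow> real"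
  assumes [measurable]: "f \<in> borel_measurable borel"
  shows "(\<lambda>u. \<integral>x. f x \<partial>next_surplus u) \<in> borel_measurable borel"
proof -
  have "(\<lambda>u. \<integral>p. f (V u (fst p) - snd p) \<partial>(MK \<Otimes>\<^sub>M MF)) \<in> borel_measurable borel"
    by measurable
  then show ?thesis by (simp add: next_surplus_def integral_distr split_def)
qed

text \<open>The upper limit \<open>V u t\<close> discards only claims that lead to a negative
  argument, where \<open>f\<close> vanishes, and the lower limits discard null sets. What remains is
  the integral against the image law, by Fubini.\<close>

lemma survival_integral_eq:
  fixes f :: "real \<Rightarrow> real"
  assumes "f \<in> borel_measurable borel" "\<And>x. \<bar>f x\<bar> \<le> B" "\<And>x. x < 0 \<Longrightarrow> f x = 0"
  shows "(LINT t:{0..}|MK. (LINT z:{0..V u t}|MF. f (V u t - z))) = (\<integral>x. f x \<partial>next_surplus u)"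
proof -
  note [measurable] = assms(1)
  have inner: "(LINT z:{0..V u t}|MF. f (V u t - z)) = (\<integral>z. f (V u t - z) \<partial>MF)" for t
    unfolding set_lebesgue_integral_def
    using MF_nonneg
    by (intro integral_cong_AE, measurable)
       (auto simp: indicator_def intro: assms(3) elim!: eventually_mono)
  show ?thesis
    unfolding inner integral_next_surplus[OF assms(1,2)]
    unfolding set_lebesgue_integral_def
    using MK_nonneg
    by (intro integral_cong_AE, measurable) (auto elim!: eventually_mono)
qed

section \<open>The exponential barrier\<close>

text \<open>The exponent is at most \<open>- L * (u - v)\<close> plus one term in the waiting time
  and one in the claim. Independence turns the expectation into a product of two moments, which
  \<open>int\<close> bounds by 1: a Lundberg-type supermartingale inequality.\<close>

lemma nn_integral_next_surplus_exp:
  assumes growth: "\<And>t. 0 \<le> t \<Longrightarrow> u + a * t \<le> V u t" and L: "0 \<le> L"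
    and int: "(\<integral>\<^sup>+z. ennreal (exp (L * z)) \<partial>MF) * (\<integral>\<^sup>+t. ennreal (exp (- a * L * t)) \<partial>MK) \<le> 1"
  shows "(\<integral>\<^sup>+x. ennreal (exp (- L * (x - v))) \<partial>next_surplus u) \<le> ennreal (exp (- L * (u - v)))"
proof -
  have "(\<integral>\<^sup>+x. ennreal (exp (- L * (x - v))) \<partial>next_surplus u)
      = (\<integral>\<^sup>+t. \<integral>\<^sup>+z. ennreal (exp (- L * (V u t - z - v))) \<partial>MF \<partial>MK)"
    by (simp add: next_surplus_def nn_integral_distr split_def MF.nn_integral_fst[symmetric])
  also have "\<dots> \<le> (\<integral>\<^sup>+t. \<integral>\<^sup>+z. ennreal (exp (- L * (u - v))) *
      (ennreal (exp (- a * L * t)) * ennreal (exp (L * z))) \<partial>MF \<partial>MK)"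
  proof (rule nn_integral_mono_AE)
    show "AE t in MK. (\<integral>\<^sup>+z. ennreal (exp (- L * (V u t - z - v))) \<partial>MF)
      \<le> (\<integral>\<^sup>+z. ennreal (exp (- L * (u - v))) * (ennreal (exp (- a * L * t)) * ennreal (exp (L * z))) \<partial>MF)"
      using MK_nonneg
    proof eventually_elim
      case (elim t)
      have "- L * (V u t - z - v) \<le> - L * (u - v) + (- a * L * t + L * z)" for z
        using mult_left_mono[OF growth[OF elim] L] by (simp add: algebra_simps)
      then show ?case
        by (intro nn_integral_mono) (simp add: ennreal_mult'[symmetric] exp_add[symmetric])
    qed
  qed
  also have "\<dots> = ennreal (exp (- L * (u - v))) *
      ((\<integral>\<^sup>+z. ennreal (exp (L * z)) \<partial>MF) * (\<integral>\<^sup>+t. ennreal (exp (- a * L * t)) \<partial>MK))"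
    by (simp add: nn_integral_cmult nn_integral_multc mult_ac)
  also have "\<dots> \<le> ennreal (exp (- L * (u - v))) * 1"
    by (intro mult_left_mono int) simp
  finally show ?thesis by simp
qed

text \<open>For \<open>u\<close> below \<open>v\<close> the left side is 0. Otherwise integrate
  \<open>phi_star L v x \<ge> 1 - exp (- L * (x - v))\<close>, valid for every \<open>x\<close> and
  an equality at \<open>x = u\<close>, and apply the exponential bound.\<close>

lemma phi_star_le_integral:
  assumes growth: "\<And>t. v \<le> u \<Longrightarrow> 0 \<le> t \<Longrightarrow> u + a * t \<le> V u t" and L: "0 \<le> L"
    and int: "(\<integral>\<^sup>+z. ennreal (exp (L * z)) \<partial>MF) * (\<integral>\<^sup>+t. ennreal (exp (- a * L * t)) \<partial>MK) \<le> 1"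
  shows "phi_star L v u \<le> (\<integral>x. phi_star L v x \<partial>next_surplus u)"
proof -
  interpret W: prob_space "next_surplus u" by (rule prob_space_next_surplus)
  have meas [measurable]: "phi_star L v \<in> borel_measurable borel"
    unfolding phi_star_def[abs_def] by measurable
  have nonneg: "0 \<le> phi_star L v x" for x by (simp add: phi_star_def)
  show ?thesis
  proof (cases "v \<le> u")
    case False
    then have "phi_star L v u = 0"
      using mult_nonneg_nonpos[OF L, of "u - v"] by (simp add: phi_star_def)
    then show ?thesis by (simp add: nonneg)
  next
    case True
    have int_star: "integrable (next_surplus u) (phi_star L v)"
      by (rule integrable_next_surplus[where B=1]) (auto simp: phi_star_def max_def)
    \<comment> \<open>Keeping the exponential as a summand on the right avoids subtraction in
      \<open>ennreal\<close>.\<close>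
    have "ennreal 1 = (\<integral>\<^sup>+x. 1 \<partial>next_surplus u)"
      using W.emeasure_space_1 by simp
    also have "\<dots> \<le> (\<integral>\<^sup>+x. ennreal (phi_star L v x) + ennreal (exp (- L * (x - v))) \<partial>next_surplus u)"
    proof (rule nn_integral_mono)
      fix x
      have "1 \<le> phi_star L v x + exp (- L * (x - v))" by (simp add: phi_star_def)
      then show "1 \<le> ennreal (phi_star L v x) + ennreal (exp (- L * (x - v)))"
        using nonneg by (simp add: ennreal_plus[symmetric] del: ennreal_plus)
    qed
    also have "\<dots> = ennreal (\<integral>x. phi_star L v x \<partial>next_surplus u) +
        (\<integral>\<^sup>+x. ennreal (exp (- L * (x - v))) \<partial>next_surplus u)"
      by (simp add: nn_integral_add nn_integral_eq_integral[OF int_star] nonneg)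
    also have "\<dots> \<le> ennreal (\<integral>x. phi_star L v x \<partial>next_surplus u) + ennreal (exp (- L * (u - v)))"
      using growth[OF True] L int by (intro add_left_mono nn_integral_next_surplus_exp)
    also have "\<dots> = ennreal ((\<integral>x. phi_star L v x \<partial>next_surplus u) + exp (- L * (u - v)))"
      by (simp add: nonneg)
    finally have "1 \<le> (\<integral>x. phi_star L v x \<partial>next_surplus u) + exp (- L * (u - v))"
      by (simp add: add_nonneg_nonneg nonneg del: ennreal_plus)
    then show ?thesis by (simp add: phi_star_def nonneg[unfolded phi_star_def])
  qed
qed

section \<open>Escape from a bounded range of surplus\<close>

text \<open>The box \<open>A \<times> B\<close> avoids the preimage of the band and, by
  independence, its mass is the product of the two factors.\<close>

lemma prob_next_surplus_band:
  assumes A: "A \<in> sets borel" and B: "B \<in> sets borel"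
    and out: "\<And>t z. t \<in> A \<Longrightarrow> z \<in> B \<Longrightarrow> V u t - z \<notin> {0..<N}"
  shows "measure (next_surplus u) {0..<N} \<le> 1 - measure MK A * measure MF B"
proof -
  let ?X = "{p. V u (fst p) - snd p \<in> {0..<N}}"
  have [measurable]: "?X \<in> sets (MK \<Otimes>\<^sub>M MF)"
  proof -
    have "{p \<in> space (MK \<Otimes>\<^sub>M MF). V u (fst p) - snd p \<in> {0..<N}} \<in> sets (MK \<Otimes>\<^sub>M MF)"
      by measurable
    then show ?thesis by (simp add: space_pair_measure)
  qed
  have AB: "A \<times> B \<in> sets (MK \<Otimes>\<^sub>M MF)" using A B by auto
  have "measure (next_surplus u) {0..<N} = measure (MK \<Otimes>\<^sub>M MF) ?X"
    by (simp add: next_surplus_def measure_distr split_def vimage_def space_pair_measure)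
  also have "\<dots> \<le> measure (MK \<Otimes>\<^sub>M MF) (space (MK \<Otimes>\<^sub>M MF) - A \<times> B)"
    using out AB by (intro P.finite_measure_mono sets.Diff sets.top) (auto simp: space_pair_measure)
  also have "\<dots> = 1 - measure MK A * measure MF B"
  proof -
    have "P.prob (A \<times> B) = measure MK A * measure MF B"
      using A B by (simp add: measure_def MF.emeasure_pair_measure_Times enn2real_mult)
    then show ?thesis by (simp only: P.prob_compl[OF AB])
  qed
  finally show ?thesis .
qed

text \<open>Condition (c) makes one of the two laws unbounded: long waiting times push the surplus
  above \<open>N\<close>, large claims push it below zero.\<close>

lemma escape_probability:
  assumes lim: "filterlim (V 0) at_top at_top"
    and unbounded: "\<And>t z. cdf MK t < 1 \<or> cdf MF z < 1"
  obtains p where "0 < p" "p \<le> 1" "\<And>u. u \<in> {0..N} \<Longrightarrow> measure (next_surplus u) {0..<N} \<le> 1 - p"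
proof -
  have ex: "\<exists>x. 0 < cdf M x" if "real_distribution M" for M
  proof -
    interpret real_distribution M by fact
    have "\<forall>\<^sub>F x in at_top. 0 < cdf M x"
      using order_tendstoD(1)[OF cdf_lim_at_top_prob, of 0] by simp
    then show ?thesis by (auto simp: eventually_at_top_linorder)
  qed
  have tail: "measure M {x<..} = 1 - cdf M x" if "real_distribution M" for M x
  proof -
    interpret real_distribution M by fact
    have "{x<..} = space M - {..x}" by auto
    then show ?thesis using prob_compl[of "{..x}"] by (simp add: cdf_def)
  qed
  \<comment> \<open>\<open>z\<^sub>1\<close> and \<open>t\<^sub>1\<close> control whichever variable
    is not the unbounded one: it stays in a half-line of positive mass.\<close>
  obtain z\<^sub>1 where z1: "0 < cdf MF z\<^sub>1" using ex[OF MF.real_distribution_axioms] by blast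
  obtain t\<^sub>1 where t1: "0 < cdf MK t\<^sub>1" using ex[OF MK.real_distribution_axioms] by blast
  \<comment> \<open>As \<open>t\<close> and \<open>z\<close> vary independently, one of the two
    inequalities must hold for all its arguments.\<close>
  consider "\<And>t. cdf MK t < 1" | "\<And>z. cdf MF z < 1" using unbounded by blast
  then obtain A B where AB: "A \<in> sets borel" "B \<in> sets borel" "0 < measure MK A" "0 < measure MF B"
    "\<And>u t z. u \<in> {0..N} \<Longrightarrow> t \<in> A \<Longrightarrow> z \<in> B \<Longrightarrow> V u t - z \<notin> {0..<N}"
  proof cases
    case 1
    \<comment> \<open>The lowest start 0 is the worst case; the margin \<open>z\<^sub>1\<close>
      leaves at least \<open>N\<close> after a claim of at most \<open>z\<^sub>1\<close>.\<close>
    obtain t\<^sub>0 where t0: "\<And>t. t\<^sub>0 \<le> t \<Longrightarrow> N + z\<^sub>1 \<le> V 0 t"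
      using lim unfolding filterlim_at_top eventually_at_top_linorder by blast
    show ?thesis
    proof (rule that[of "{t\<^sub>0<..}" "{..z\<^sub>1}"])
      show "0 < measure MK {t\<^sub>0<..}" using 1 tail[OF MK.real_distribution_axioms] by simp
      show "0 < measure MF {..z\<^sub>1}" using z1 by (simp add: cdf_def)
      show "V u t - z \<notin> {0..<N}" if "u \<in> {0..N}" "t \<in> {t\<^sub>0<..}" "z \<in> {..z\<^sub>1}" for u t z
        using t0[of t] monoD[OF mono_V, of 0 u t] that by auto
    qed auto
  next
    case 2
    show ?thesis
    \<comment> \<open>\<open>V N t\<^sub>1\<close> bounds every surplus reached from
      \<open>{0..N}\<close> by time \<open>t\<^sub>1\<close>, so a larger claim ruins.\<close>
    proof (rule that[of "{..t\<^sub>1}" "{V N t\<^sub>1<..}"])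
      show "0 < measure MK {..t\<^sub>1}" using t1 by (simp add: cdf_def)
      show "0 < measure MF {V N t\<^sub>1<..}" using 2 tail[OF MF.real_distribution_axioms] by simp
      show "V u t - z \<notin> {0..<N}" if "u \<in> {0..N}" "t \<in> {..t\<^sub>1}" "z \<in> {V N t\<^sub>1<..}" for u t z
        using monoD[OF mono_V, of u N t] monoD[OF mono_V_time, of t t\<^sub>1 N] that by auto
    qed auto
  qed
  show ?thesis
  proof (rule that[of "measure MK A * measure MF B"])
    show "measure MK A * measure MF B \<le> 1"
      by (intro mult_le_one) auto
    show "0 < measure MK A * measure MF B" using AB by simp
    show "measure (next_surplus u) {0..<N} \<le> 1 - measure MK A * measure MF B"
      if "u \<in> {0..N}" for u
      using AB(1,2) AB(5)[OF that] by (rule prob_next_surplus_band)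
  qed
qed

section \<open>Contraction of large errors\<close>

text \<open>Pointwise \<open>\<bar>h x\<bar>\<close> is at most \<open>M / 2\<close>, plus another
  \<open>M / 2\<close> on the band only, so the integral is at most
  \<open>M / 2 * (1 + (1 - p))\<close>.\<close>

lemma integral_contraction:
  fixes h :: "real \<Rightarrow> real"
  assumes [measurable]: "h \<in> borel_measurable borel"
    and neg: "\<And>x. x < 0 \<Longrightarrow> h x = 0"
    and bound: "\<And>x. \<bar>h x\<bar> \<le> M" and far: "\<And>x. N \<le> x \<Longrightarrow> \<bar>h x\<bar> \<le> M / 2"
    and band: "measure (next_surplus u) {0..<N} \<le> 1 - p"
  shows "\<bar>\<integral>x. h x \<partial>next_surplus u\<bar> \<le> (1 - p / 2) * M"
proof -
  interpret W: prob_space "next_surplus u" by (rule prob_space_next_surplus)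
  have M: "0 \<le> M" using bound[of 0] by simp
  have "\<bar>\<integral>x. h x \<partial>next_surplus u\<bar> \<le> (\<integral>x. \<bar>h x\<bar> \<partial>next_surplus u)"
    by (rule integral_abs_bound)
  also have "\<dots> \<le> (\<integral>x. M / 2 + M / 2 * indicator {0..<N} x \<partial>next_surplus u)"
  proof (rule integral_mono)
    show "integrable (next_surplus u) (\<lambda>x. \<bar>h x\<bar>)"
      using bound by (intro integrable_next_surplus[of _ M]) auto
    show "\<bar>h x\<bar> \<le> M / 2 + M / 2 * indicator {0..<N} x" for x
      using bound[of x] far[of x] neg[of x] M by (auto simp: indicator_def not_le not_less)
    show "integrable (next_surplus u) (\<lambda>x. M / 2 + M / 2 * indicator {0..<N} x)"
      using M by (intro integrable_next_surplus[of _ M]) (auto simp: indicator_def)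
  qed
  also have "\<dots> = M / 2 + M / 2 * measure (next_surplus u) {0..<N}"
  proof -
    have "integrable (next_surplus u) (\<lambda>x. M / 2 * indicator {0..<N} x)"
      using M by (intro integrable_next_surplus[of _ M]) (auto simp: indicator_def)
    then show ?thesis
      by (subst Bochner_Integration.integral_add) (auto simp: W.prob_space[simplified])
  qed
  also have "\<dots> \<le> M / 2 + M / 2 * (1 - p)"
    using band M by (intro add_left_mono mult_left_mono) auto
  also have "\<dots> = (1 - p / 2) * M" by (simp add: field_simps)
  finally show ?thesis .
qed

end

section \<open>Distribution functions, and the barrier at infinity\<close>

text \<open>The mass of \<open>{..<0}\<close> is the left limit of the distribution function at 0.
  Using \<open>at_left\<close> allows an atom at 0, which the waiting time may have.\<close>

lemma AE_nonneg_of_cdf: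
  assumes "real_distribution M" and zero: "\<And>x. x < 0 \<Longrightarrow> cdf M x = 0"
  shows "AE x in M. 0 \<le> x"
proof -
  interpret real_distribution M by fact
  have "(cdf M \<longlongrightarrow> 0) (at_left 0)"
    by (rule tendsto_eventually) (auto simp: eventually_at_left_field zero intro: exI[of _ "-1"])
  then have "prob {..<0} = 0"
    using tendsto_unique[OF _ cdf_at_left] by (metis trivial_limit_at_left_real)
  then have "{..<0} \<in> null_sets M" by (auto simp: null_sets_def emeasure_eq_measure)
  then show ?thesis by (rule AE_I') auto
qed

lemma distribution_function_interval_measure:
  assumes "distribution_function G"
  shows "real_distribution (interval_measure G)" "cdf (interval_measure G) = G"
  using assms unfolding distribution_function_def
  by (auto intro!: real_distribution_interval_measure cdf_interval_measure dest: monoD)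

lemma eventually_phi_star_ge:
  assumes L: "0 < L" and e: "0 < e"
  shows "\<forall>\<^sub>F x in at_top. 1 - e \<le> phi_star L v x"
  \<comment> \<open>The threshold solves \<open>exp (- L * (x - v)) = e\<close>.\<close>
  using eventually_ge_at_top[of "v - ln e / L"]
proof eventually_elim
  case (elim x)
  then have "- L * (x - v) \<le> ln e" using L by (simp add: field_simps)
  then have "exp (- L * (x - v)) \<le> e" using e by (metis exp_le_cancel_iff exp_ln)
  then show ?case by (simp add: phi_star_def)
qed

theorem theorem5p2:
  fixes F K c :: "real \<Rightarrow> real"
    and U :: "real \<Rightarrow> real \<Rightarrow> real"
    and u_star c_star L :: real
    and \<phi> :: "real \<Rightarrow> real"
    and \<psi> :: "nat \<Rightarrow> real \<Rightarrow> real"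
  assumes F: "distribution_function F" "\<forall>z\<le>0. F z = 0"
    and K: "distribution_function K" "\<forall>t<0. K t = 0"
    and c: "piecewise_continuous_halfline c" "\<forall>x\<ge>0. c x \<ge> 0"
    and U: "the_cauchy_flow c U"
    and a_mono_u: "\<forall>t\<ge>0. mono_on {0..} (\<lambda>u. U u t)"
    and a_mono_t: "\<forall>u\<ge>0. mono_on {0..} (\<lambda>t. U u t)"
    and a_lim: "\<forall>u\<ge>0. filterlim (\<lambda>t. U u t) at_top at_top"
    and b_const: "u_star \<ge> 0" "c_star > 0" "L > 0"
    and b_growth: "\<forall>u\<ge>u_star. \<forall>t\<ge>0. U u t \<ge> u + c_star * t"
    and b_int: "(\<integral>\<^sup>+z\<in>{0..}. ennreal (exp (L * z)) \<partial>interval_measure F) *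
                (\<integral>\<^sup>+t\<in>{0..}. ennreal (exp (- c_star * L * t)) \<partial>interval_measure K) \<le> 1"
    and c_cond: "\<forall>t\<ge>0. \<forall>z\<ge>0. K t * F z < 1"
    and phi_range: "\<forall>u\<ge>0. 0 \<le> \<phi> u \<and> \<phi> u \<le> 1"
    and phi_mono: "mono_on {0..} \<phi>"
    and phi_fix: "\<forall>u\<ge>0. \<phi> u = survival_op U F K \<phi> u"
    and phi_lim: "(\<phi> \<longlongrightarrow> 1) at_top"
    and psi0_meas: "set_borel_measurable borel {0..} (\<psi> 0)"
    and psi0_bounds: "\<forall>u\<ge>0. phi_star L u_star u \<le> \<psi> 0 u \<and> \<psi> 0 u \<le> 1"
    and psi_Suc: "\<forall>k. \<forall>u\<ge>0. \<psi> (Suc k) u = survival_op U F K (\<psi> k) u"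
  shows "uniform_limit {0..} \<psi> \<phi> sequentially \<and>
         decseq (\<lambda>k. sup_dist (\<psi> k) \<phi>) \<and>
         (\<lambda>k. sup_dist (\<psi> k) \<phi>) \<longlonglongrightarrow> 0 \<and>
         (\<forall>\<epsilon>>0. \<exists>q. 0 \<le> q \<and> q < 1 \<and>
            (\<forall>k. sup_dist (\<psi> k) \<phi> \<ge> \<epsilon> \<longrightarrow>
                 sup_dist (\<psi> k) \<phi> \<le> q ^ k * sup_dist (\<psi> 0) \<phi>))"
proof -

  \<comment> \<open>Transfer to the kernel setting\<close>
  \<comment> \<open>Clamping both arguments at 0 gives monotonicity and continuity on the whole line
    and leaves nonnegative arguments untouched.\<close>
  define V where "V u t = U (max 0 u) (max 0 t)" for u t
  define MF where "MF = interval_measure F"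
  define MK where "MK = interval_measure K"
  note distF = distribution_function_interval_measure[OF F(1), folded MF_def]
  note distK = distribution_function_interval_measure[OF K(1), folded MK_def]
  have MF_nonneg: "AE z in MF. 0 \<le> z" and MK_nonneg: "AE t in MK. 0 \<le> t"
    using F(2) K(2) distF distK by (auto intro!: AE_nonneg_of_cdf)
  interpret surplus_model MF MK V
  proof (intro surplus_model.intro surplus_model_axioms.intro distF(1) distK(1) MF_nonneg MK_nonneg)
    fix u t :: real
    show "mono (\<lambda>u. V u t)"
      unfolding V_def by (rule monoI, rule mono_onD[OF a_mono_u[rule_format]]) auto
    show "mono (V u)"
      unfolding V_def by (rule monoI, rule mono_onD[OF a_mono_t[rule_format]]) auto
    have "continuous_on {0..} (U (max 0 u))"
      using U by (simp add: the_cauchy_flow_def cauchy_solution_def)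
    then have "continuous_on UNIV (\<lambda>t. U (max 0 u) (max 0 t))"
      by (rule continuous_on_compose2) (auto intro!: continuous_intros)
    then show "continuous_on UNIV (V u)" by (simp add: V_def[abs_def])
  qed

  \<comment> \<open>Values of \<open>\<phi>\<close> and \<open>\<psi> k\<close> at negative
    arguments are arbitrary. \<open>survival_op\<close> never reads them, so replacing them by 0
    does not change it.\<close>
  define cut :: "(real \<Rightarrow> real) \<Rightarrow> real \<Rightarrow> real" where "cut \<eta> x = indicator {0..} x * \<eta> x" for \<eta> x
  have cut_nonneg: "x \<ge> 0 \<Longrightarrow> cut \<eta> x = \<eta> x" and cut_neg: "x < 0 \<Longrightarrow> cut \<eta> x = 0" for \<eta> x
    by (auto simp: cut_def)
  have op_eq: "survival_op U F K \<eta> u = (\<integral>x. cut \<eta> x \<partial>next_surplus u)"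
    if "cut \<eta> \<in> borel_measurable borel" "\<And>x. \<bar>cut \<eta> x\<bar> \<le> 1" "u \<ge> 0" for \<eta> u
  proof -
    have "survival_op U F K \<eta> u = (LINT t:{0..}|MK. (LINT z:{0..V u t}|MF. cut \<eta> (V u t - z)))"
      unfolding survival_op_def MF_def[symmetric] MK_def[symmetric]
      by (intro set_lebesgue_integral_cong)
         (auto simp: V_def cut_nonneg that(3) intro!: set_lebesgue_integral_cong)
    also have "\<dots> = (\<integral>x. cut \<eta> x \<partial>next_surplus u)"
      using that cut_neg by (intro survival_integral_eq) auto
    finally show ?thesis .
  qed

  have star_step: "phi_star L u_star u \<le> (\<integral>x. phi_star L u_star x \<partial>next_surplus u)" if "u \<ge> 0" for u
  proof (rule phi_star_le_integral[where a=c_star])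
    \<comment> \<open>Both laws live on the half-line, so condition (b) may be read with integrals
      over the whole line.\<close>
    have "(\<integral>\<^sup>+z\<in>{0..}. ennreal (exp (L * z)) \<partial>MF) = (\<integral>\<^sup>+z. ennreal (exp (L * z)) \<partial>MF)"
      using MF_nonneg by (intro nn_integral_cong_AE) (auto elim!: eventually_mono)
    moreover have "(\<integral>\<^sup>+t\<in>{0..}. ennreal (exp (- c_star * L * t)) \<partial>MK)
        = (\<integral>\<^sup>+t. ennreal (exp (- c_star * L * t)) \<partial>MK)"
      using MK_nonneg by (intro nn_integral_cong_AE) (auto elim!: eventually_mono)
    ultimately show "(\<integral>\<^sup>+z. ennreal (exp (L * z)) \<partial>MF) * (\<integral>\<^sup>+t. ennreal (exp (- c_star * L * t)) \<partial>MK) \<le> 1"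
      using b_int[folded MF_def MK_def] by simp
  qed (use that b_growth b_const in \<open>auto simp: V_def\<close>)
  have star_range: "0 \<le> phi_star L u_star x" "phi_star L u_star x \<le> 1" for x
    by (auto simp: phi_star_def)
  have star_neg: "phi_star L u_star x = 0" if "x < 0" for x
    using mult_nonneg_nonpos[of L "x - u_star"] that b_const by (simp add: phi_star_def)
  have star_meas [measurable]: "phi_star L u_star \<in> borel_measurable borel"
    unfolding phi_star_def[abs_def] by measurable

  \<comment> \<open>Measurability and bounds of the iterates\<close>
  \<comment> \<open>One joint induction, because measurability and bounds together let the next
    iterate be written as an integral against \<open>next_surplus u\<close>. The lower bound
    survives since integration is monotone and \<open>star_step\<close> makes
    \<open>phi_star\<close> a subsolution, the upper one since the kernel has mass 1.\<close>
  have psi: "cut (\<psi> k) \<in> borel_measurable borel \<and>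
      (\<forall>x. phi_star L u_star x \<le> cut (\<psi> k) x \<and> cut (\<psi> k) x \<le> 1)" for k
  proof (induction k)
    case 0
    have "cut (\<psi> 0) \<in> borel_measurable borel"
      using psi0_meas by (simp add: set_borel_measurable_def cut_def[abs_def])
    moreover have "phi_star L u_star x \<le> cut (\<psi> 0) x \<and> cut (\<psi> 0) x \<le> 1" for x
      using psi0_bounds star_neg by (cases "x \<ge> 0") (auto simp: cut_nonneg cut_neg)
    ultimately show ?case by blast
  next
    case (Suc k)
    then have meas [measurable]: "cut (\<psi> k) \<in> borel_measurable borel"
      and lower: "\<And>x. phi_star L u_star x \<le> cut (\<psi> k) x" and upper: "\<And>x. cut (\<psi> k) x \<le> 1"
      by auto
    have bound: "\<bar>cut (\<psi> k) x\<bar> \<le> 1" for x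
      using lower[of x] upper[of x] star_range[of x] by linarith
    have step: "\<psi> (Suc k) u = (\<integral>x. cut (\<psi> k) x \<partial>next_surplus u)" if "u \<ge> 0" for u
      using psi_Suc op_eq[OF meas bound] that by simp
    have "cut (\<psi> (Suc k)) = (\<lambda>u. indicator {0..} u * (\<integral>x. cut (\<psi> k) x \<partial>next_surplus u))"
      using step by (auto simp: cut_def indicator_def fun_eq_iff)
    also have "\<dots> \<in> borel_measurable borel"
      using measurable_integral_next_surplus[OF meas] by measurable
    finally have "cut (\<psi> (Suc k)) \<in> borel_measurable borel" .
    moreover have "phi_star L u_star u \<le> cut (\<psi> (Suc k)) u \<and> cut (\<psi> (Suc k)) u \<le> 1" for u
    proof (cases "u \<ge> 0")
      case True
      interpret W: prob_space "next_surplus u" by (rule prob_space_next_surplus)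
      have int: "integrable (next_surplus u) (cut (\<psi> k))"
        by (rule integrable_next_surplus[OF meas bound])
      have "(\<integral>x. phi_star L u_star x \<partial>next_surplus u) \<le> (\<integral>x. cut (\<psi> k) x \<partial>next_surplus u)"
        using lower star_range
        by (intro integral_mono int integrable_next_surplus[where B=1])
           (auto simp: abs_le_iff intro: order_trans)
      moreover have "(\<integral>x. cut (\<psi> k) x \<partial>next_surplus u) \<le> 1"
        using upper by (intro W.integral_le_const int) auto
      ultimately show ?thesis
        using star_step[OF True] by (simp add: cut_nonneg True step)
    qed (simp add: cut_neg star_neg)
    ultimately show ?case by blast
  qed
  then have psi_meas [measurable]: "\<And>k. cut (\<psi> k) \<in> borel_measurable borel"
    and psi_lower: "\<And>k x. phi_star L u_star x \<le> cut (\<psi> k) x" and psi_upper: "\<And>k x. cut (\<psi> k) x \<le> 1"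
    by auto
  have psi_nonneg: "0 \<le> cut (\<psi> k) x" for k x
    using psi_lower star_range order_trans by blast
  have phi_nonneg: "0 \<le> cut \<phi> x" and phi_upper: "cut \<phi> x \<le> 1" for x
    using phi_range by (auto simp: cut_def indicator_def)
  \<comment> \<open>As \<open>\<phi>\<close> is nondecreasing and nonnegative, its extension by 0 is
    nondecreasing on the line, hence Borel.\<close>
  have phi_meas [measurable]: "cut \<phi> \<in> borel_measurable borel"
  proof (intro borel_measurable_mono monoI)
    fix x y :: real assume "x \<le> y"
    then show "cut \<phi> x \<le> cut \<phi> y"
      using phi_nonneg[of y] mono_onD[OF phi_mono, of x y]
      by (cases "x \<ge> 0") (auto simp: cut_nonneg cut_neg)
  qed

  \<comment> \<open>The error and its supremum norm\<close>
  define h where "h k x = cut (\<psi> k) x - cut \<phi> x" for k x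
  have h_meas [measurable]: "h k \<in> borel_measurable borel" for k
    unfolding h_def[abs_def] by measurable
  have h_bound: "\<bar>h k x\<bar> \<le> 1" for k x
    using psi_nonneg[of k x] psi_upper[of k x] phi_nonneg[of x] phi_upper[of x] by (simp add: h_def)
  have h_neg: "h k x = 0" if "x < 0" for k x
    using that by (simp add: h_def cut_neg)
  \<comment> \<open>The operator is linear and fixes \<open>\<phi>\<close>, so the kernel alone
    propagates the error.\<close>
  have h_Suc: "h (Suc k) u = (\<integral>x. h k x \<partial>next_surplus u)" if "u \<ge> 0" for k u
  proof -
    have b: "\<bar>cut (\<psi> k) x\<bar> \<le> 1" "\<bar>cut \<phi> x\<bar> \<le> 1" for x
      using psi_nonneg[of k x] psi_upper[of k x] phi_nonneg[of x] phi_upper[of x] by auto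
    have "h (Suc k) u = survival_op U F K (\<psi> k) u - survival_op U F K \<phi> u"
      using that psi_Suc phi_fix by (simp add: h_def cut_nonneg)
    also have "\<dots> = (\<integral>x. cut (\<psi> k) x \<partial>next_surplus u) - (\<integral>x. cut \<phi> x \<partial>next_surplus u)"
      using b that by (simp add: op_eq)
    also have "\<dots> = (\<integral>x. h k x \<partial>next_surplus u)"
      unfolding h_def
      by (intro Bochner_Integration.integral_diff[symmetric] integrable_next_surplus[where B=1] b)
         measurable
    finally show ?thesis .
  qed

  define d where "d k = sup_dist (\<psi> k) \<phi>" for k
  have d_eq: "d k = (SUP u\<in>{0..}. \<bar>h k u\<bar>)" for k
    unfolding d_def sup_dist_def by (intro SUP_cong) (auto simp: h_def cut_nonneg)
  \<comment> \<open>\<open>h_bound\<close> matters here: a real supremum dominates its members only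
    if the set is bounded above.\<close>
  have h_le_d0: "\<bar>h k u\<bar> \<le> d k" if "u \<ge> 0" for k u
    unfolding d_eq using h_bound that by (intro cSUP_upper bdd_aboveI2[where M=1]) auto
  have d_nonneg: "0 \<le> d k" for k
    using h_le_d0[of 0 k] by simp
  have h_le_d: "\<bar>h k x\<bar> \<le> d k" for k x
    using h_le_d0[of x k] d_nonneg[of k] h_neg[of x k] by (cases "x \<ge> 0") auto
  have d_least: "d k \<le> B" if "\<And>u. u \<ge> 0 \<Longrightarrow> \<bar>h k u\<bar> \<le> B" for k B
    unfolding d_eq using that by (intro cSUP_least) auto

  \<comment> \<open>Averaging against a probability measure cannot enlarge the supremum
    norm.\<close>
  have dec: "decseq d"
  proof (rule decseq_SucI, rule d_least)
    fix k and u :: real assume u: "u \<ge> 0"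
    interpret W: prob_space "next_surplus u" by (rule prob_space_next_surplus)
    have "\<bar>h (Suc k) u\<bar> \<le> (\<integral>x. \<bar>h k x\<bar> \<partial>next_surplus u)"
      unfolding h_Suc[OF u] by (rule integral_abs_bound)
    also have "\<dots> \<le> d k"
      using h_le_d h_bound by (intro W.integral_le_const integrable_next_surplus[where B=1]) auto
    finally show "\<bar>h (Suc k) u\<bar> \<le> d k" .
  qed

  \<comment> \<open>One-step contraction above a given level\<close>
  have contr: "\<exists>q. 0 \<le> q \<and> q < 1 \<and> (\<forall>k. \<epsilon> \<le> d k \<longrightarrow> d (Suc k) \<le> q * d k)" if \<epsilon>: "0 < \<epsilon>" for \<epsilon>
  proof -
    \<comment> \<open>Far out, \<open>\<phi>\<close> and every iterate lie in
      \<open>{1 - \<epsilon> / 2..1}\<close>. The barrier \<open>phi_star\<close> does not depend on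
      \<open>k\<close>, so one \<open>N\<close> serves all iterates.\<close>
    have "\<forall>\<^sub>F x in at_top. 1 - \<epsilon> / 2 < \<phi> x"
      using order_tendstoD(1)[OF phi_lim, of "1 - \<epsilon> / 2"] \<epsilon> by simp
    moreover have "\<forall>\<^sub>F x in at_top. 1 - \<epsilon> / 2 \<le> phi_star L u_star x"
      using b_const \<epsilon> by (intro eventually_phi_star_ge) auto
    ultimately have "\<forall>\<^sub>F x in at_top. \<forall>k. \<bar>h k x\<bar> \<le> \<epsilon> / 2"
      using eventually_ge_at_top[of 0]
    proof eventually_elim
      case (elim x)
      show ?case
      proof
        fix k
        show "\<bar>h k x\<bar> \<le> \<epsilon> / 2"
          using elim psi_lower[of x k] psi_upper[of k x] phi_upper[of x]
          unfolding h_def cut_nonneg[OF elim(3)] by linarith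
      qed
    qed
    then obtain N where far: "\<And>k x. N \<le> x \<Longrightarrow> \<bar>h k x\<bar> \<le> \<epsilon> / 2"
      by (auto simp: eventually_at_top_linorder)
    have lim: "filterlim (V 0) at_top at_top"
    proof (rule filterlim_mono_eventually[OF a_lim[rule_format, of 0] order_refl order_refl])
      show "\<forall>\<^sub>F t in at_top. U 0 t = V 0 t"
        using eventually_ge_at_top[of 0] by eventually_elim (simp add: V_def)
    qed simp
    \<comment> \<open>Condition (c) speaks of nonnegative arguments only; raising \<open>t\<close>
      and \<open>z\<close> to at least 0 keeps both values at least 1.\<close>
    have unbounded: "cdf MK t < 1 \<or> cdf MF z < 1" for t z
    proof (rule ccontr)
      assume neg: "\<not> (cdf MK t < 1 \<or> cdf MF z < 1)"
      have "1 \<le> cdf MK (max 0 t)" "1 \<le> cdf MF (max 0 z)"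
        using neg MK.cdf_nondecreasing[of t "max 0 t"] MF.cdf_nondecreasing[of z "max 0 z"] by auto
      then have "1 * 1 \<le> cdf MK (max 0 t) * cdf MF (max 0 z)" by (intro mult_mono) auto
      moreover have "K (max 0 t) * F (max 0 z) < 1" using c_cond by simp
      ultimately show False by (simp add: distF distK)
    qed
    obtain p where p: "0 < p" "p \<le> 1" "\<And>u. u \<in> {0..N} \<Longrightarrow> measure (next_surplus u) {0..<N} \<le> 1 - p"
      using escape_probability[OF lim unbounded] by blast
    have "d (Suc k) \<le> (1 - p / 2) * d k" if large: "\<epsilon> \<le> d k" for k
    proof (rule d_least)
      fix u :: real assume u: "u \<ge> 0"
      show "\<bar>h (Suc k) u\<bar> \<le> (1 - p / 2) * d k"
      \<comment> \<open>Up to \<open>N\<close>, \<open>integral_contraction\<close> applies with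
        \<open>M = d k\<close>. Beyond \<open>N\<close> the tail bound for the next iterate already
        gives the factor \<open>1 / 2\<close>, which is at most \<open>1 - p / 2\<close> as
        \<open>p \<le> 1\<close>. Both cases use \<open>\<epsilon> \<le> d k\<close> to turn
        \<open>\<epsilon> / 2\<close> into \<open>d k / 2\<close>.\<close>
      proof (cases "u \<le> N")
        case True
        have "\<bar>h k x\<bar> \<le> d k / 2" if "N \<le> x" for x
          using far[OF that, of k] large by linarith
        then show ?thesis
          unfolding h_Suc[OF u] using h_le_d h_neg p(3) u True
          by (intro integral_contraction[where N=N]) auto
      next
        case False
        then have "\<bar>h (Suc k) u\<bar> \<le> 1 / 2 * d k" using far[of u "Suc k"] large by simp
        also have "\<dots> \<le> (1 - p / 2) * d k" using p d_nonneg by (intro mult_right_mono) auto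
        finally show ?thesis .
      qed
    qed
    \<comment> \<open>\<open>N\<close> and \<open>p\<close> were chosen before \<open>k\<close>, so
      the factor is the same for all \<open>k\<close>.\<close>
    then show ?thesis using p by (intro exI[of _ "1 - p / 2"]) auto
  qed

  \<comment> \<open>Convergence and the geometric rate\<close>
  have conv: "d \<longlonglongrightarrow> 0"
    and geo: "\<forall>\<epsilon>>0. \<exists>q. 0 \<le> q \<and> q < 1 \<and> (\<forall>k. d k \<ge> \<epsilon> \<longrightarrow> d k \<le> q ^ k * d 0)"
    using geometric_while_large[OF dec d_nonneg] contr by blast+
  have "uniform_limit {0..} \<psi> \<phi> sequentially"
  proof (rule uniform_limitI)
    fix e :: real assume "0 < e"
    from order_tendstoD(2)[OF conv this]
    show "\<forall>\<^sub>F k in sequentially. \<forall>x\<in>{0..}. dist (\<psi> k x) (\<phi> x) < e"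
    proof eventually_elim
      case (elim k)
      then show ?case using h_le_d0[of _ k] by (force simp: h_def cut_nonneg dist_real_def)
    qed
  qed
  then show ?thesis using dec conv geo by (simp add: d_def[abs_def])
qed

end
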